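(* Let $p$ be an odd prime. Then \[ \sum_{k=0}^{p-1}\frac{92k^2+61k+9}{(2k+1)64^k}\binom{2k}{k}\binom{3k}{k}\binom{4k}{2k}\equiv 9p \pmod{p^3}. \]
   Context: Congruences between rational numbers whose denominators are prime to $p$ are understood in the ring of $p$-integral rationals: $a\equiv b \pmod{p^m}$ means $(a-b)/p^m$ is a rational number with denominator prime to $p$. *)

theory Defs
  imports Complex_Main "HOL-Computational_Algebra.Primes"
begin

text \<open>\<^const>\<open>quotient_of\<close> returns numerator and denominator in lowest terms.\<close>

definition p_integral :: "nat \<Rightarrow> rat \<Rightarrow> bool" where
  "p_integral p x \<longleftrightarrow> coprime (snd (quotient_of x)) (int p)"

text \<open>
  Congruence modulo \<open>p ^ m\<close>. The numbers \<open>a\<close> and \<open>b\<close> need not be \<open>p\<close>-integral themselves,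
  only \<open>(a - b) / p ^ m\<close>.
\<close>

definition rat_cong_pow :: "nat \<Rightarrow> nat \<Rightarrow> rat \<Rightarrow> rat \<Rightarrow> bool" where
  "rat_cong_pow p m a b \<longleftrightarrow> p_integral p ((a - b) / of_nat p ^ m)"

end

theory Submission
  imports Defs
begin

text \<open>
  Write \<open>b j = binom (2j) j / 4 ^ j\<close> and let \<open>S N\<close> be the sum of the first \<open>N\<close> terms. A WZ pair gives
  \<open>S N = 12 N b N (\<Sum>j<2N. binom (N+j-1) j b j)\<close>. For \<open>N = p\<close> the terms of the inner sum with index
  \<open>i\<close> and \<open>p + i\<close>, \<open>1 \<le> i < p\<close>, are both \<open>p b i / i\<close> modulo \<open>p\<^sup>2\<close>, and
  \<open>\<Sum>i. b i / i\<close> is minus the harmonic number of order \<open>(p-1)/2\<close>, that is \<open>(2 ^ p - 2) / p\<close>, modulo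
  \<open>p\<close>. With \<open>w = 2 ^ p\<close> the remaining error is
  \<open>-3 (w - 2) ^ 3 (3w + 2) / w ^ 4\<close>, which vanishes even modulo \<open>p ^ 3\<close>.
\<close>

section \<open>A telescoping identity\<close>

text \<open>This is (-1)^j binom(-1/2, j), the coefficient of x^j in (1 - x)^(-1/2). Modulo p the
  upper index -1/2 becomes (p-1)/2.\<close>

definition central :: "nat \<Rightarrow> rat" where
  "central j = of_nat ((2 * j) choose j) / 4 ^ j"

lemma central_0 [simp]: "central 0 = 1"
  by (simp add: central_def)

lemma of_nat_binomial_absorb_comp:
  "of_nat (Suc k) * (of_nat (n choose Suc k) :: rat) = (of_nat n - of_nat k) * of_nat (n choose k)"
proof (cases "k \<le> n")
  case True
  then have "Suc k * (n choose Suc k) = (n - k) * (n choose k)"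
    by (simp only: binomial_absorb_comp binomial_absorption)
  with True show ?thesis
    by (metis of_nat_diff of_nat_mult)
qed (simp add: binomial_eq_0)

lemma of_nat_Suc_times_binomial:
  "of_nat (Suc k) * (of_nat (Suc n choose Suc k) :: rat) = of_nat (Suc n) * of_nat (n choose k)"
  by (metis Suc_times_binomial of_nat_mult)

lemma central_Suc: "central (Suc j) = central j * of_nat (2 * j + 1) / of_nat (2 * (j + 1))"
proof -
  let ?A = "of_nat ((2 * j) choose j) :: rat"
  let ?B = "of_nat (Suc (2 * j) choose Suc j) :: rat"
  let ?C = "of_nat (Suc (Suc (2 * j)) choose Suc j) :: rat"
  have "of_nat (Suc j) * ?B = of_nat (Suc (2 * j)) * ?A"
    by (rule of_nat_Suc_times_binomial)
  moreover have "?C = 2 * ?B"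
    using binomial_symmetric[of j "Suc (2 * j)"] by (simp add: Suc_diff_le)
  ultimately have "of_nat (Suc j) * ?C = 2 * (of_nat (Suc (2 * j)) * ?A)"
    by (metis mult.left_commute)
  then have C: "?C = 2 * of_nat (Suc (2 * j)) * ?A / of_nat (Suc j)"
    by (simp add: field_simps del: binomial_Suc_Suc)
  have "central (Suc j) = 2 * of_nat (Suc (2 * j)) * ?A / of_nat (Suc j) / 4 ^ Suc j"
    unfolding C[symmetric] by (simp add: central_def del: binomial_Suc_Suc)
  also have "\<dots> = central j * of_nat (2 * j + 1) / of_nat (2 * (j + 1))"
    by (simp add: central_def divide_simps del: binomial_Suc_Suc)
      (simp add: algebra_simps)
  finally show ?thesis .
qed

text \<open>Induction on N. The summands F(N,j) on the right, prefactor included, satisfy F(N+1,j) -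
  F(N,j) = W(j+1) - W(j), so over a fixed range of j the increment is a boundary value of W. Since
  the range of j grows by two, two further terms enter; together these give the new term on the
  left.\<close>

lemma truncated_sum_eq:
  assumes "1 \<le> N"
  shows "(\<Sum>k<N. (92 * of_nat k ^ 2 + 61 * of_nat k + 9) / ((2 * of_nat k + 1) * 64 ^ k)
           * of_nat ((2 * k) choose k) * of_nat ((3 * k) choose k) * of_nat ((4 * k) choose (2 * k)))
       = 12 * of_nat N * central N * (\<Sum>j<2 * N. of_nat ((N + j - 1) choose j) * central j)"
  (is "(\<Sum>k<N. ?t k) = ?P N * ?A N")
  using assms
proof (induction N rule: dec_induct)
  case base
  show ?case by (simp add: central_def lessThan_Suc numeral_2_eq_2)
next
  case (step N)
  then have N: "of_nat N \<noteq> (0 :: rat)" by simp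
  let ?n = "of_nat N :: rat"
  define c where "c j = (of_nat ((N + j) choose j) :: rat)" for j
  \<comment> \<open>The WZ certificate. Its factor j^2 gives W 0 = 0 and cancels the factors j + 1
    in the denominators of \<open>c_Suc\<close> and \<open>central_Suc\<close>.\<close>
  define W where "W j = 12 * central N * central j * c j * of_nat j ^ 2 / of_nat (N + j)" for j
  have pos: "?n + of_nat j \<noteq> 0" for j
    using step.hyps by (metis of_nat_add of_nat_eq_0_iff add_is_0 not_one_le_zero)
  have c_Suc: "c (Suc j) = c j * of_nat (N + j + 1) / of_nat (j + 1)" for j
    using of_nat_Suc_times_binomial[of j "N + j"] by (simp add: c_def field_simps del: binomial_Suc_Suc)
  have c_pred: "of_nat ((N + j - 1) choose j) = c j * ?n / of_nat (N + j)" for j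
  proof -
    have "(N + j) * ((N + j - 1) choose j) = N * ((N + j) choose j)"
      using binomial_absorb_comp[of "N + j" j] by simp
    then have "of_nat (N + j) * of_nat ((N + j - 1) choose j) = ?n * c j"
      unfolding c_def by (metis of_nat_mult)
    then show ?thesis using pos[of j] by (simp add: field_simps)
  qed
  have P_Suc: "?P (Suc N) = 6 * (2 * ?n + 1) * central N"
    by (simp add: central_Suc divide_simps) (simp add: algebra_simps)
  have tele: "?P (Suc N) * (of_nat ((Suc N + j - 1) choose j) * central j)
      - ?P N * (of_nat ((N + j - 1) choose j) * central j) = W (Suc j) - W j" for j
  proof -
    \<comment> \<open>In this form all four quantities in \<open>tele\<close> are rational multiples
      of \<open>central N * central j * c j\<close>, and an identity of rational functions in N and
      j remains.\<close>
    have "W (Suc j) = 12 * central N * central j * c j * (of_nat (2 * j + 1) / 2)"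
      using pos[of j] pos[of "Suc j"] unfolding W_def central_Suc c_Suc
      by (simp add: divide_simps power2_eq_square) (simp add: algebra_simps)?
    then show ?thesis
      unfolding P_Suc c_pred W_def[of j] using pos[of j]
      by (simp add: c_def[symmetric] divide_simps power2_eq_square) (simp add: algebra_simps)?
  qed
  have "?P (Suc N) * (\<Sum>j<2 * N. of_nat ((Suc N + j - 1) choose j) * central j) - ?P N * ?A N
      = (\<Sum>j<2 * N. W (Suc j) - W j)"
    unfolding tele[symmetric] by (simp add: sum_distrib_left sum_subtractf)
  also have "\<dots> = W (2 * N)"
    by (subst sum_lessThan_telescope) (simp add: W_def)
  finally have main: "?P (Suc N) * (\<Sum>j<2 * N. of_nat ((Suc N + j - 1) choose j) * central j)
      = ?P N * ?A N + W (2 * N)" by simp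
  have split: "?A (Suc N) = (\<Sum>j<2 * N. of_nat ((Suc N + j - 1) choose j) * central j)
      + c (2 * N) * central (2 * N) + c (Suc (2 * N)) * central (Suc (2 * N))"
    by (simp add: c_def)
  have c3: "c (2 * N) = of_nat ((3 * N) choose N)"
    using binomial_symmetric[of "2 * N" "3 * N"] by (simp add: c_def)
  have t: "?t N = (92 * ?n ^ 2 + 61 * ?n + 9) / (2 * ?n + 1) * central N * c (2 * N) * central (2 * N)"
  proof -
    \<comment> \<open>The power is shared out: 4^N belongs to binom(2N,N) and 4^(2N) to
      binom(4N,2N), which leaves binom(3N,N) = \<open>c (2 * N)\<close>.\<close>
    have "(64 :: rat) ^ N = 4 ^ N * 4 ^ (2 * N)"
      by (simp add: power_mult power_mult_distrib[symmetric])
    then show ?thesis by (simp add: c3 central_def)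
  qed
  have odd: "2 * ?n + 1 \<noteq> 0"
    by (metis of_nat_1 of_nat_add of_nat_eq_0_iff of_nat_mult of_nat_numeral add_is_0 one_neq_zero)
  \<comment> \<open>After the common factor \<open>central N * central (2 * N) * c (2 * N)\<close>
    is taken out, the polynomial 92 N^2 + 61 N + 9 appears as the numerator over 2N + 1.\<close>
  have "W (2 * N) + ?P (Suc N) * (c (2 * N) * central (2 * N) + c (Suc (2 * N)) * central (Suc (2 * N)))
     = ?t N"
  proof -
    have W2: "W (2 * N) = 16 * ?n * central N * central (2 * N) * c (2 * N)"
      using N by (simp add: W_def power2_eq_square)
    have e: "c (Suc (2 * N)) * central (Suc (2 * N)) =
      c (2 * N) * central (2 * N) * (3 * ?n + 1) * (4 * ?n + 1) / (2 * (2 * ?n + 1)^2)"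
      using odd by (simp add: c_Suc central_Suc divide_simps power2_eq_square) (simp add: algebra_simps)?
    have "W (2 * N) + ?P (Suc N) * (c (2 * N) * central (2 * N) + c (Suc (2 * N)) * central (Suc (2 * N)))
      = central N * central (2 * N) * c (2 * N) *
        (16 * ?n + 6 * (2 * ?n + 1) * (1 + (3 * ?n + 1) * (4 * ?n + 1) / (2 * (2 * ?n + 1)^2)))"
      unfolding P_Suc W2 e by (simp add: algebra_simps)
    also have "16 * ?n + 6 * (2 * ?n + 1) * (1 + (3 * ?n + 1) * (4 * ?n + 1) / (2 * (2 * ?n + 1)^2))
      = (92 * ?n ^ 2 + 61 * ?n + 9) / (2 * ?n + 1)"
      using odd by (simp add: divide_simps) (simp add: algebra_simps power2_eq_square power3_eq_cube)
    finally show ?thesis unfolding t by (simp only: mult_ac)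
  qed
  then have "?P (Suc N) * ?A (Suc N) = ?P N * ?A N + ?t N"
    unfolding split add.assoc distrib_left[of "?P (Suc N)" "sum _ _"] main by linarith
  then show ?case
    using step.IH by (simp only: sum.lessThan_Suc)
qed

section \<open>Finite identities for harmonic sums\<close>

lemma alternating_sum_binomial_inverse:
  "(\<Sum>i=1..m. (-1) ^ i * of_nat (m choose i) / of_nat i :: rat) = - (\<Sum>i=1..m. 1 / of_nat i)"
proof (induction m)
  case (Suc m)
  \<comment> \<open>Pascal's rule splits off binom(m, i-1), and absorption turns binom(m, i-1) / i
    into binom(m+1, i) / (m+1), whose denominator no longer depends on i.\<close>
  have pascal: "(-1) ^ i * of_nat (Suc m choose i) / of_nat i
      = (-1) ^ i * of_nat (m choose i) / of_nat i + (-1) ^ i * of_nat (Suc m choose i) / (of_nat (Suc m) :: rat)"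
    if i: "i \<ge> 1" for i
  proof -
    obtain k where k: "i = Suc k" using i by (cases i) auto
    have "of_nat (m choose k) / of_nat (Suc k) = (of_nat (Suc m choose Suc k) / of_nat (Suc m) :: rat)"
      using of_nat_Suc_times_binomial[of k m] by (simp add: divide_simps mult_ac del: binomial_Suc_Suc of_nat_Suc)
    moreover have "(of_nat (Suc m choose Suc k) :: rat) = of_nat (m choose k) + of_nat (m choose Suc k)"
      by simp
    moreover have "s * c / d = s * y / d + s * c / e" if "x / d = c / e" "c = x + y" for s c d e x y :: rat
    proof -
      have "s * c / d = s * y / d + s * (x / d)"
        using that(2) by (simp add: distrib_left add_divide_distrib)
      then show ?thesis unfolding that(1) by simp
    qed
    ultimately show ?thesis
      unfolding k by blast
  qed
  \<comment> \<open>The full alternating row sum is 0. Without index 0 it is -1, so the induction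
    step contributes -1/(m+1).\<close>
  have "(\<Sum>i\<le>Suc m. (-1) ^ i * of_nat (Suc m choose i) :: rat) = 0"
    by (rule choose_alternating_sum) simp
  then have alt: "(\<Sum>i=1..Suc m. (-1) ^ i * of_nat (Suc m choose i) :: rat) = - 1"
    by (simp add: atMost_atLeast0 sum.atLeast_Suc_atMost[of 0] del: binomial_Suc_Suc sum.cl_ivl_Suc)
  have "(\<Sum>i=1..Suc m. (-1) ^ i * of_nat (Suc m choose i) / of_nat i :: rat)
      = (\<Sum>i=1..Suc m. (-1) ^ i * of_nat (m choose i) / of_nat i
          + (-1) ^ i * of_nat (Suc m choose i) / of_nat (Suc m))"
    by (intro sum.cong refl pascal) auto
  also have "\<dots> = (\<Sum>i=1..m. (-1) ^ i * of_nat (m choose i) / of_nat i)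
      + (\<Sum>i=1..Suc m. (-1) ^ i * of_nat (Suc m choose i)) / of_nat (Suc m)"
    unfolding sum.distrib sum_divide_distrib by (simp add: binomial_eq_0 del: binomial_Suc_Suc of_nat_Suc)
  also have "\<dots> = - (\<Sum>i=1..Suc m. 1 / of_nat i)"
    unfolding alt Suc.IH by simp
  finally show ?case .
qed simp

lemma sum_lessThan_add: "(\<Sum>j<a + b. f j) = (\<Sum>j<a. f j) + (\<Sum>i<b. f (a + i :: nat) :: 'a :: comm_monoid_add)"
  by (induction b) (simp_all add: add.assoc)

text \<open>From m to m+1 the right side loses 1/(m+1) and gains 1/(2m+1) + 1/(2m+2). Since 1/(m+1)
  = 2/(2m+2), this is the gain 1/(2m+1) - 1/(2m+2) of the left side.\<close>

lemma sum_alternating_inverse: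
  "(\<Sum>k=1..2 * m. (-1) ^ (k - 1) / of_nat k :: rat) = (\<Sum>k=m + 1..2 * m. 1 / of_nat k)"
proof (induction m)
  case (Suc m)
  have "(\<Sum>k=1..2 * Suc m. (-1) ^ (k - 1) / of_nat k :: rat)
      = (\<Sum>k=m + 1..2 * m. 1 / of_nat k) + 1 / of_nat (2 * m + 1) - 1 / of_nat (2 * m + 2)"
    using Suc.IH by simp
  also have "(\<Sum>k=m + 1..2 * m. 1 / of_nat k :: rat) + 1 / of_nat (2 * m + 1) = (\<Sum>k=m + 1..2 * m + 1. 1 / of_nat k)"
    by simp
  also have "(\<Sum>k=m + 1..2 * m + 1. 1 / of_nat k :: rat) = 1 / of_nat (m + 1) + (\<Sum>k=Suc m + 1..2 * m + 1. 1 / of_nat k)"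
    by (subst sum.atLeast_Suc_atMost) auto
  also have "1 / of_nat (m + 1) + (\<Sum>k=Suc m + 1..2 * m + 1. 1 / of_nat k) - 1 / of_nat (2 * m + 2)
      = (\<Sum>k=Suc m + 1..2 * m + 1. 1 / of_nat k) + 1 / (of_nat (2 * m + 2) :: rat)"
    by (simp add: divide_simps) (simp add: algebra_simps)?
  also have "\<dots> = (\<Sum>k=Suc m + 1..2 * Suc m. 1 / of_nat k)"
    by simp
  finally show ?case .
qed simp

section \<open>Congruences between rational numbers\<close>

text \<open>The reduced denominator divides every other denominator, so any fraction with
  denominator prime to p is a witness. Closure under sums and products then follows from the usual
  fraction formulas.\<close>

lemma p_integral_iff:
  assumes "prime p"
  shows "p_integral p x \<longleftrightarrow> (\<exists>a b. coprime b (int p) \<and> x = of_int a / of_int b)"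
proof
  assume "p_integral p x"
  moreover obtain a b where "quotient_of x = (a, b)" by force
  ultimately show "\<exists>a b. coprime b (int p) \<and> x = of_int a / of_int b"
    using quotient_of_div[of x a b] by (auto simp: p_integral_def)
next
  assume "\<exists>a b. coprime b (int p) \<and> x = of_int a / of_int b"
  then obtain a b where b: "coprime b (int p)" and x: "x = of_int a / of_int b" by blast
  obtain c d where q: "quotient_of x = (c, d)" by force
  have d: "d > 0" "coprime c d" "x = of_int c / of_int d"
    using q quotient_of_denom_pos quotient_of_coprime quotient_of_div by blast+
  have "b \<noteq> 0"
    using b assms by (auto simp: prime_gt_1_nat nat_neq_iff dest: prime_gt_1_nat)
  then have "(of_int (a * d) :: rat) = of_int (c * b)"
    using d x by (simp add: field_simps)
  then have "a * d = c * b" using of_int_eq_iff by blast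
  then have "d dvd c * b" by (metis dvd_triv_right)
  moreover have "coprime d c" using d(2) by (simp add: coprime_commute)
  ultimately have "d dvd b" by (simp add: coprime_dvd_mult_right_iff)
  then have "coprime d (int p)" by (rule coprime_divisors[OF _ dvd_refl b])
  then show "p_integral p x" by (simp add: p_integral_def q)
qed

context
  fixes p :: nat
  assumes p: "prime p"
begin

lemma p_integral_of_int [simp]: "p_integral p (of_int a)"
  by (simp add: p_integral_iff[OF p]) (metis coprime_1_left div_by_1 of_int_1)

lemma p_integral_of_nat [simp]: "p_integral p (of_nat a)"
  by (metis of_int_of_nat_eq p_integral_of_int)

lemma p_integral_numeral [simp]: "p_integral p 0" "p_integral p 1" "p_integral p (numeral w)"
  by (metis of_nat_0 p_integral_of_nat, metis of_nat_1 p_integral_of_nat,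
      metis of_nat_numeral p_integral_of_nat)

lemma p_integral_mult [intro, simp]: "p_integral p x \<Longrightarrow> p_integral p y \<Longrightarrow> p_integral p (x * y)"
  unfolding p_integral_iff[OF p]
  by (metis coprime_mult_left_iff of_int_mult times_divide_times_eq)

lemma p_integral_add [intro, simp]:
  assumes "p_integral p x" "p_integral p y"
  shows "p_integral p (x + y)"
proof -
  obtain a b c d where *: "coprime b (int p)" "x = of_int a / of_int b"
      "coprime d (int p)" "y = of_int c / of_int d"
    using assms unfolding p_integral_iff[OF p] by blast
  then have "b \<noteq> 0" "d \<noteq> 0" using p by (auto dest: prime_gt_1_nat)
  then have "x + y = of_int (a * d + c * b) / of_int (b * d)"
    using * by (simp add: field_simps)
  moreover have "coprime (b * d) (int p)" using * by simp
  ultimately show ?thesis unfolding p_integral_iff[OF p] by (intro exI conjI)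
qed

lemma p_integral_uminus [simp]: "p_integral p x \<Longrightarrow> p_integral p (- x)"
  using p_integral_mult[OF p_integral_of_int[of "- 1"], of x] by simp

lemma p_integral_diff [simp]: "p_integral p x \<Longrightarrow> p_integral p y \<Longrightarrow> p_integral p (x - y)"
  using p_integral_add[of x "- y"] by simp

lemma p_integral_power [simp]: "p_integral p x \<Longrightarrow> p_integral p (x ^ n)"
  by (induction n) auto

lemma p_integral_sum: "(\<And>i. i \<in> I \<Longrightarrow> p_integral p (f i)) \<Longrightarrow> p_integral p (sum f I)"
  by (induction I rule: infinite_finite_induct) auto

lemma p_integral_divide_nat:
  assumes "p_integral p x" "coprime n p"
  shows "p_integral p (x / of_nat n)"
proof -
  have "p_integral p (1 / of_nat n)"
    unfolding p_integral_iff[OF p] using assms(2)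
    by (metis coprime_int_iff of_int_1 of_int_of_nat_eq)
  then show ?thesis using p_integral_mult[OF assms(1)] by force
qed

lemma p_nonzero [simp]: "p \<noteq> 0"
  using p by (metis not_prime_0)

lemma rat_cong_pow_refl [simp]: "rat_cong_pow p m a a"
  by (simp add: rat_cong_pow_def)

lemma rat_cong_powI: "a - b = of_nat p ^ m * r \<Longrightarrow> p_integral p r \<Longrightarrow> rat_cong_pow p m a b"
  by (simp add: rat_cong_pow_def)

lemma rat_cong_pow_sym: "rat_cong_pow p m a b \<Longrightarrow> rat_cong_pow p m b a"
  unfolding rat_cong_pow_def
  by (metis minus_diff_eq minus_divide_left p_integral_uminus)

lemma rat_cong_pow_add:
  "rat_cong_pow p m a b \<Longrightarrow> rat_cong_pow p m c d \<Longrightarrow> rat_cong_pow p m (a + c) (b + d)"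
  unfolding rat_cong_pow_def by (metis add_diff_add add_divide_distrib p_integral_add)

lemma rat_cong_pow_trans [trans]:
  "rat_cong_pow p m a b \<Longrightarrow> rat_cong_pow p m b c \<Longrightarrow> rat_cong_pow p m a c"
  using rat_cong_pow_add[of m a b b c] by (simp add: rat_cong_pow_def)

lemma rat_cong_pow_sum:
  "(\<And>i. i \<in> I \<Longrightarrow> rat_cong_pow p m (f i) (g i)) \<Longrightarrow> rat_cong_pow p m (sum f I) (sum g I)"
  by (induction I rule: infinite_finite_induct) (auto intro: rat_cong_pow_add)

lemma rat_cong_pow_mult_left:
  "rat_cong_pow p m a b \<Longrightarrow> p_integral p c \<Longrightarrow> rat_cong_pow p m (c * a) (c * b)"
  unfolding rat_cong_pow_def
  by (metis p_integral_mult right_diff_distrib times_divide_eq_right)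

text \<open>From a c - b d = a (c - d) + (a - b) d, which explains why integrality is assumed of
  \<open>a\<close> and \<open>d\<close>.\<close>

lemma rat_cong_pow_mult:
  assumes "rat_cong_pow p m a b" "rat_cong_pow p m c d" "p_integral p a" "p_integral p d"
  shows "rat_cong_pow p m (a * c) (b * d)"
  using rat_cong_pow_mult_left[OF assms(2,3)] rat_cong_pow_mult_left[OF assms(1,4)]
  by (metis mult.commute rat_cong_pow_trans)

text \<open>An explicit factor p raises the precision by one power; every passage from p to p^2, and
  finally to p^3, is made in this way.\<close>

lemma rat_cong_pow_prime_mult:
  "rat_cong_pow p m a b \<Longrightarrow> rat_cong_pow p (Suc m) (of_nat p * a) (of_nat p * b)"
  by (simp add: rat_cong_pow_def right_diff_distrib[symmetric])

lemma rat_cong_pow_divide_nat: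
  assumes "rat_cong_pow p m a b" "coprime n p"
  shows "rat_cong_pow p m (a / of_nat n) (b / of_nat n)"
  using rat_cong_pow_mult_left[OF assms(1), of "1 / of_nat n"] p_integral_divide_nat[OF _ assms(2), of 1]
  by simp

lemma rat_cong_add_prime: "rat_cong_pow p 1 (of_nat (c * p + n)) (of_nat n)"
  by (rule rat_cong_powI[where r = "of_nat c"]) auto

lemma rat_cong_cross_divide:
  assumes "rat_cong_pow p m (a * of_nat d) (c * of_nat b)" "coprime b p" "coprime d p"
  shows "rat_cong_pow p m (a / of_nat b) (c / of_nat d)"
proof -
  have "b \<noteq> 0" "d \<noteq> 0" using assms p by (metis coprime_0_left_iff not_prime_unit)+
  then show ?thesis
    using rat_cong_pow_divide_nat[OF rat_cong_pow_divide_nat[OF assms(1,2)] assms(3)]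
    by simp
qed

lemma rat_cong_pow_lower:
  assumes "rat_cong_pow p 2 a b"
  shows "rat_cong_pow p 1 a b"
proof -
  have "(a - b) / of_nat p ^ 1 = of_nat p * ((a - b) / of_nat p ^ 2)"
    using p_nonzero by (simp add: power2_eq_square)
  moreover have "p_integral p \<dots>"
    using assms unfolding rat_cong_pow_def by (intro p_integral_mult p_integral_of_nat)
  ultimately show ?thesis by (simp only: rat_cong_pow_def)
qed


section \<open>Units and binomial coefficients modulo p\<close>

lemma coprime_below: "0 < n \<Longrightarrow> n < p \<Longrightarrow> coprime n p"
  using p by (metis coprime_commute nat_dvd_not_less prime_imp_coprime)

lemma coprime_mult_add: "0 < n \<Longrightarrow> n < p \<Longrightarrow> coprime (c * p + n) p"
  using coprime_below[of n] unfolding coprime_iff_gcd_eq_1 gcd.commute[of _ p] gcd_add_mult by simp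

lemma rat_cong_divide:
  assumes "rat_cong_pow p 1 a c" "rat_cong_pow p 1 (of_nat b) (of_nat d)"
    and "coprime b p" "coprime d p" "p_integral p a"
  shows "rat_cong_pow p 1 (a / of_nat b) (c / of_nat d)"
proof (rule rat_cong_cross_divide[OF _ assms(3,4)])
  have "rat_cong_pow p 1 (a * of_nat d) (a * of_nat b)"
    by (rule rat_cong_pow_mult_left[OF rat_cong_pow_sym[OF assms(2)] assms(5)])
  moreover have "rat_cong_pow p 1 (a * of_nat b) (c * of_nat b)"
    by (rule rat_cong_pow_mult[OF assms(1)]) (simp_all add: p assms)
  ultimately show "rat_cong_pow p 1 (a * of_nat d) (c * of_nat b)"
    by (rule rat_cong_pow_trans)
qed

text \<open>An instance of Lucas' theorem. The ratio of consecutive coefficients is ((c+1)p + n+1) /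
  (cp + n+1); numerator and denominator are both n+1 modulo p, a unit as long as n+1 < p.\<close>

lemma binomial_add_mod:
  "n < p \<Longrightarrow> rat_cong_pow p 1 (of_nat ((Suc c * p + n) choose p)) (of_nat ((Suc c * p) choose p))"
proof (induction n)
  case (Suc n)
  let ?N = "Suc c * p + n"
  have "(Suc ?N - p) * (Suc ?N choose p) = Suc ?N * (?N choose p)"
    using binomial_absorb_comp[of "Suc ?N" p] by simp
  then have "of_nat (c * p + Suc n) * of_nat (Suc ?N choose p) = of_nat (Suc ?N) * (of_nat (?N choose p) :: rat)"
    unfolding of_nat_mult[symmetric] by simp
  then have "of_nat (Suc ?N choose p) = of_nat (?N choose p) * of_nat (Suc ?N) / (of_nat (c * p + Suc n) :: rat)"
    by (simp add: field_simps del: of_nat_Suc binomial_Suc_Suc)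
  moreover have "rat_cong_pow p 1 \<dots> (of_nat ((Suc c * p) choose p) * of_nat (Suc n) / of_nat (Suc n))"
  proof (rule rat_cong_divide)
    have "rat_cong_pow p 1 (of_nat (Suc ?N)) (of_nat (Suc n))"
      using rat_cong_add_prime[of "Suc c" "Suc n"] by simp
    then show "rat_cong_pow p 1 (of_nat (?N choose p) * of_nat (Suc ?N))
        (of_nat ((Suc c * p) choose p) * of_nat (Suc n))"
      using Suc by (intro rat_cong_pow_mult) (simp_all add: p del: of_nat_Suc)
    show "coprime (c * p + Suc n) p" "coprime (Suc n) p"
      using Suc.prems by (auto intro: coprime_mult_add coprime_below simp del: add_Suc_right)
    show "rat_cong_pow p 1 (of_nat (c * p + Suc n)) (of_nat (Suc n))"
      by (rule rat_cong_add_prime)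
  qed (simp add: p del: of_nat_Suc)
  ultimately show ?case by (simp del: of_nat_Suc binomial_Suc_Suc)
qed (simp add: p)

section \<open>Powers of two and central binomial coefficients for p = 2m + 1\<close>

context
  fixes m :: nat
  assumes m: "p = 2 * m + 1"
begin

lemma coprime_two_power: "coprime (2 ^ n) p"
  using m by (simp add: coprime_commute)

lemma coprime_four_power: "coprime (4 ^ n) p"
  using coprime_two_power[of "2 * n"] by (simp add: power_mult)

lemma coprime_double: "0 < n \<Longrightarrow> n < p \<Longrightarrow> coprime (2 * n) p"
  using coprime_two_power[of 1] by (simp only: power_one_right coprime_mult_left_iff coprime_below)

lemma p_integral_central: "p_integral p (central j)"
  using p_integral_divide_nat[OF p_integral_of_nat coprime_four_power, of "(2 * j) choose j" j]
  by (simp add: central_def)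

lemma minus_prime_mod: "rat_cong_pow p 1 (x - of_nat p) x"
  by (rule rat_cong_powI[where r = "- 1"]) (simp_all add: p)

text \<open>The ratio of consecutive coefficients is (p-k-1)/(k+1), which is -1 modulo p.\<close>

lemma binomial_prime_pred_mod: "k < p \<Longrightarrow> rat_cong_pow p 1 (of_nat ((p - 1) choose k)) ((-1) ^ k)"
proof (induction k)
  case (Suc k)
  have "of_nat (Suc k) * of_nat ((p - 1) choose Suc k)
      = (of_nat p - of_nat (Suc k)) * (of_nat ((p - 1) choose k) :: rat)"
    using of_nat_binomial_absorb_comp[of k "p - 1"] m by simp
  then have "of_nat ((p - 1) choose Suc k)
      = (of_nat p - of_nat (Suc k)) * of_nat ((p - 1) choose k) / (of_nat (Suc k) :: rat)"
    by (simp add: field_simps del: of_nat_Suc)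
  moreover have "rat_cong_pow p 1 \<dots> (- of_nat (Suc k) * (-1) ^ k / of_nat (Suc k))"
  proof (intro rat_cong_pow_divide_nat rat_cong_pow_mult)
    show "rat_cong_pow p 1 (of_nat p - of_nat (Suc k)) (- of_nat (Suc k))"
      by (rule rat_cong_powI[where r = 1]) (simp_all add: p)
    show "coprime (Suc k) p"
      using Suc.prems by (intro coprime_below) auto
  qed (use Suc p in \<open>simp_all del: of_nat_Suc\<close>)
  moreover have "- of_nat (Suc k) * (-1) ^ k / (of_nat (Suc k) :: rat) = (-1) ^ Suc k"
    by (simp del: of_nat_Suc)
  ultimately show ?case by (simp only:)
qed (simp add: p)

text \<open>The ends of row p of Pascal's triangle account for the 2. Each inner entry is (p/k)
  binom(p-1, k-1), that is (-1)^(k-1) p/k modulo p^2, and the alternating sum of 1/k collapses to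
  its upper half.\<close>

lemma power_two_mod:
  "rat_cong_pow p 2 (2 ^ p - 2) (of_nat p * - (\<Sum>i=1..m. 1 / of_nat i))"
proof -
  have "p > 1" using p prime_gt_1_nat by blast
  have "(\<Sum>k\<le>p. p choose k) = 2 ^ p" by (rule choose_row_sum)
  then have "(2 :: rat) ^ p = of_nat (\<Sum>k\<le>p. p choose k)" by simp
  also have "{..p} = insert 0 (insert p {1..2 * m})"
    using m by auto
  finally have "(2 :: rat) ^ p - 2 = (\<Sum>k=1..2 * m. of_nat (p choose k))"
    using m by (simp del: binomial_Suc_Suc)
  also have "\<dots> = (\<Sum>k=1..2 * m. of_nat p * (of_nat ((p - 1) choose (k - 1)) / of_nat k))"
  proof (rule sum.cong[OF refl])
    fix k assume "k \<in> {1..2 * m}"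
    then obtain j where j: "k = Suc j" using not0_implies_Suc[of k] by auto
    show "of_nat (p choose k) = of_nat p * (of_nat ((p - 1) choose (k - 1)) / (of_nat k :: rat))"
      using of_nat_Suc_times_binomial[of j "p - 1"] \<open>p > 1\<close> unfolding j
      by (simp add: field_simps del: binomial_Suc_Suc of_nat_Suc)
  qed
  also have "\<dots> = of_nat p * (\<Sum>k=1..2 * m. of_nat ((p - 1) choose (k - 1)) / of_nat k)"
    by (simp add: sum_distrib_left)
  finally have eq: "(2 :: rat) ^ p - 2 = \<dots>" .
  have "rat_cong_pow p 1 (\<Sum>k=1..2 * m. of_nat ((p - 1) choose (k - 1)) / of_nat k)
      (\<Sum>k=1..2 * m. (-1) ^ (k - 1) / of_nat k)"
    using m by (intro rat_cong_pow_sum rat_cong_pow_divide_nat binomial_prime_pred_mod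
        coprime_below) auto
  \<comment> \<open>Since p = 2m + 1, the reflection of k to p - k maps m+1..2m onto 1..m; modulo p
    it changes the sign of each reciprocal.\<close>
  moreover have "(\<Sum>k=1..2 * m. (-1) ^ (k - 1) / of_nat k :: rat) = (\<Sum>i=1..m. 1 / of_nat (p - i))"
    unfolding sum_alternating_inverse
    by (rule sum.reindex_bij_witness[of _ "\<lambda>i. p - i" "\<lambda>i. p - i"]) (use m in auto)
  moreover have "rat_cong_pow p 1 (\<Sum>i=1..m. 1 / of_nat (p - i)) (\<Sum>i=1..m. - 1 / of_nat i)"
  proof (intro rat_cong_pow_sum rat_cong_cross_divide)
    fix i assume i: "i \<in> {1..m}"
    have "1 * of_nat i - - 1 * of_nat (p - i) = of_nat p ^ 1 * (1 :: rat)"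
      using i m by (simp add: of_nat_diff)
    then show "rat_cong_pow p 1 (1 * of_nat i) (- 1 * of_nat (p - i))"
      by (rule rat_cong_powI) (simp add: p)
    have "0 < p - i" "p - i < p" "0 < i" "i < p"
      using i m by auto
    then show "coprime (p - i) p" "coprime i p"
      by (simp_all add: coprime_below)
  qed
  ultimately have "rat_cong_pow p 1 (\<Sum>k=1..2 * m. of_nat ((p - 1) choose (k - 1)) / of_nat k)
      (- (\<Sum>i=1..m. 1 / of_nat i))"
    by (metis (no_types, lifting) rat_cong_pow_trans minus_divide_left sum.cong sum_negf)
  from rat_cong_pow_prime_mult[OF this] show ?thesis
    unfolding eq by (simp add: numeral_2_eq_2)
qed

text \<open>As m is -1/2 modulo p, binom(m,i) stands for binom(-1/2,i). The induction compares the
  ratios (2i+1)/(2(i+1)) and (2i+1-p)/(2(i+1)), with denominators that are units for i+1 <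
  p.\<close>

lemma central_mod: "i < p \<Longrightarrow> rat_cong_pow p 1 (central i) ((-1) ^ i * of_nat (m choose i))"
proof (induction i)
  case (Suc i)
  have "of_nat (Suc i) * of_nat (m choose Suc i) = (of_nat m - of_nat i) * (of_nat (m choose i) :: rat)"
    by (rule of_nat_binomial_absorb_comp)
  then have C: "of_nat (m choose Suc i) = (of_nat m - of_nat i) * (of_nat (m choose i) :: rat) / of_nat (Suc i)"
    by (simp add: field_simps del: binomial_Suc_Suc of_nat_Suc)
  have "(-1) ^ Suc i * of_nat (m choose Suc i)
      = ((-1) ^ i * of_nat (m choose i)) * (of_nat (2 * i + 1) - of_nat p) / (of_nat (2 * (i + 1)) :: rat)"
    unfolding C by (simp add: m divide_simps del: binomial_Suc_Suc) (simp add: algebra_simps)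
  moreover have "rat_cong_pow p 1 (central (Suc i)) \<dots>"
    unfolding central_Suc
  proof (intro rat_cong_pow_divide_nat rat_cong_pow_mult)
    show "rat_cong_pow p 1 (of_nat (2 * i + 1)) (of_nat (2 * i + 1) - of_nat p)"
      by (rule rat_cong_pow_sym[OF minus_prime_mod])
    show "coprime (2 * (i + 1)) p"
      using Suc.prems by (intro coprime_double) auto
  qed (use Suc p p_integral_central in \<open>simp_all\<close>)
  ultimately show ?case by (simp only:)
qed (simp add: p)

lemma sum_central_mod:
  "rat_cong_pow p 2 (of_nat p * (\<Sum>i=1..p - 1. central i / of_nat i)) (2 ^ p - 2)"
proof -
  have "rat_cong_pow p 1 (\<Sum>i=1..p - 1. central i / of_nat i)
      (\<Sum>i=1..p - 1. (-1) ^ i * of_nat (m choose i) / of_nat i)"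
    by (intro rat_cong_pow_sum rat_cong_pow_divide_nat central_mod coprime_below) auto
  \<comment> \<open>The terms with i > m vanish because binom(m,i) = 0.\<close>
  also have "(\<Sum>i=1..p - 1. (-1) ^ i * of_nat (m choose i) / of_nat i :: rat)
      = (\<Sum>i=1..m. (-1) ^ i * of_nat (m choose i) / of_nat i)"
    by (rule sum.mono_neutral_right) (use m in \<open>auto simp: binomial_eq_0\<close>)
  also have "\<dots> = - (\<Sum>i=1..m. 1 / of_nat i)"
    by (rule alternating_sum_binomial_inverse)
  finally have "rat_cong_pow p 1 (\<Sum>i=1..p - 1. central i / of_nat i) (- (\<Sum>i=1..m. 1 / of_nat i))" .
  from rat_cong_pow_prime_mult[OF this]
  have "rat_cong_pow p 2 (of_nat p * (\<Sum>i=1..p - 1. central i / of_nat i))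
      (of_nat p * - (\<Sum>i=1..m. 1 / of_nat i))"
    by (simp only: Suc_1)
  then show ?thesis
    by (rule rat_cong_pow_trans[OF _ rat_cong_pow_sym[OF power_two_mod]])
qed

text \<open>Fermat's little theorem for base 2, read off from \<open>power_two_mod\<close> because
  the harmonic sum there is p-integral.\<close>

lemma power_two_mod_prime: "rat_cong_pow p 1 (2 ^ p) 2"
proof -
  have "coprime i p" if "i \<in> {1..m}" for i
    using that m by (intro coprime_below) auto
  then have h: "p_integral p (- (\<Sum>i=1..m. 1 / of_nat i))" (is "p_integral p ?h")
    by (intro p_integral_uminus p_integral_sum p_integral_divide_nat) (simp_all add: p)
  have e: "(a - b) / c ^ 1 = c * ((a - b - c * d) / c ^ 2) + d" if "c \<noteq> 0" for a b c d :: rat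
    using that by (simp add: field_simps power2_eq_square)
  have "(2 ^ p - 2) / of_nat p ^ 1 = of_nat p * ((2 ^ p - 2 - of_nat p * ?h) / of_nat p ^ 2) + ?h"
    by (rule e) simp
  moreover have "p_integral p \<dots>"
    using power_two_mod h unfolding rat_cong_pow_def
    by (intro p_integral_add p_integral_mult p_integral_of_nat)
  ultimately show ?thesis by (simp only: rat_cong_pow_def)
qed

section \<open>Central binomial coefficients at index p and beyond\<close>

lemma binomial_double_prime_mod: "rat_cong_pow p 2 (of_nat ((2 * p) choose p)) 2"
proof -
  have "p > 1" using p prime_gt_1_nat by blast
  then have set: "{..p} = insert 0 (insert p {1..p - 1})" by auto
  \<comment> \<open>Vandermonde's sum of squares: the two end terms give 2, and p divides every
    other binom(p,k), hence p^2 its square.\<close>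
  have "((2 * p) choose p) = (\<Sum>k\<le>p. (p choose k)\<^sup>2)"
    by (rule choose_square_sum[symmetric])
  also have "\<dots> = 2 + (\<Sum>k=1..p - 1. (p choose k)\<^sup>2)"
    unfolding set using \<open>p > 1\<close> by simp
  finally have "((2 * p) choose p) = 2 + (\<Sum>k=1..p - 1. (p choose k)\<^sup>2)" .
  moreover have "p\<^sup>2 dvd (\<Sum>k=1..p - 1. (p choose k)\<^sup>2)"
    using p by (intro dvd_sum) (auto simp: dvd_power_iff intro!: dvd_choose_prime dvd_power_same)
  ultimately obtain r where "((2 * p) choose p) = 2 + p\<^sup>2 * r"
    by (metis dvdE)
  then show ?thesis
    by (intro rat_cong_powI[where r = "of_nat r"]) (simp_all add: p)
qed

lemma central_prime_mod: "rat_cong_pow p 2 (central p) (2 / 4 ^ p)"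
  using rat_cong_pow_divide_nat[OF binomial_double_prime_mod coprime_four_power[of p]]
  by (simp add: central_def)

text \<open>Fermat gives 4^p = 4 modulo p, so 2 / 4^p reduces to 1/2.\<close>

lemma central_prime_mod_half: "rat_cong_pow p 1 (central p) (1 / 2)"
proof -
  have "rat_cong_pow p 1 (2 ^ p * 2 ^ p) (2 * 2)"
    using power_two_mod_prime by (intro rat_cong_pow_mult) (simp_all add: p)
  then have "rat_cong_pow p 1 (2 * 2) (1 * 4 ^ p)"
    using rat_cong_pow_sym by (simp add: power_mult_distrib[symmetric])
  then have "rat_cong_pow p 1 (2 / of_nat (4 ^ p)) (1 / of_nat 2)"
    using coprime_four_power[of 1] coprime_two_power[of 1]
    by (intro rat_cong_cross_divide) simp_all
  then show ?thesis
    using rat_cong_pow_trans[OF rat_cong_pow_lower[OF central_prime_mod]] by simp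
qed

text \<open>The ratio (2j+1)/(2j+2) of consecutive values is unchanged modulo p when j is replaced
  by p + j, so the initial factor 1/2 from \<open>central p\<close> persists up to i = p -
  1.\<close>

lemma central_add_mod: "i < p \<Longrightarrow> rat_cong_pow p 1 (central (p + i)) (1 / 2 * central i)"
proof (induction i)
  case (Suc i)
  have "central (p + Suc i) = central (p + i) * of_nat (2 * p + (2 * i + 1)) / of_nat (2 * p + 2 * (i + 1))"
    using central_Suc[of "p + i"] by (simp add: algebra_simps)
  moreover have "rat_cong_pow p 1 \<dots> (1 / 2 * central i * of_nat (2 * i + 1) / of_nat (2 * (i + 1)))"
  proof (rule rat_cong_divide)
    show "rat_cong_pow p 1 (central (p + i) * of_nat (2 * p + (2 * i + 1))) (1 / 2 * central i * of_nat (2 * i + 1))"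
      using Suc by (intro rat_cong_pow_mult rat_cong_add_prime)
        (simp_all only: p_integral_central p_integral_of_nat Suc_lessD)
    show "rat_cong_pow p 1 (of_nat (2 * p + 2 * (i + 1))) (of_nat (2 * (i + 1)))"
      by (rule rat_cong_add_prime)
    show c: "coprime (2 * (i + 1)) p"
      using Suc.prems by (intro coprime_double) auto
    show "coprime (2 * p + 2 * (i + 1)) p"
      using c unfolding coprime_iff_gcd_eq_1 gcd.commute[of _ p] gcd_add_mult .
    show "p_integral p (central (p + i) * of_nat (2 * p + (2 * i + 1)))"
      by (intro p_integral_mult p_integral_central p_integral_of_nat)
  qed
  moreover have "1 / 2 * central i * of_nat (2 * i + 1) / of_nat (2 * (i + 1)) = 1 / 2 * central (Suc i)"
    by (simp add: central_Suc)
  ultimately show ?case by (simp only:)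
qed (use central_prime_mod_half in simp)

section \<open>The inner sum modulo p^2\<close>

lemma binomial_shift:
  assumes "j \<ge> 1"
  shows "(of_nat ((p + j - 1) choose j) :: rat) = of_nat p * (of_nat ((p + (j - 1)) choose p) / of_nat j)"
proof -
  obtain k where k: "j = Suc k" using assms not0_implies_Suc[of j] by auto
  have "of_nat (Suc k) * of_nat ((p + k) choose Suc k) = (of_nat p :: rat) * of_nat ((p + k) choose k)"
    using of_nat_binomial_absorb_comp[of k "p + k"] by simp
  moreover have "(p + k) choose k = (p + k) choose p"
    using binomial_symmetric[of k "p + k"] by simp
  ultimately show ?thesis
    unfolding k by (simp add: field_simps del: of_nat_Suc)
qed

text \<open>The indices 0, 1..p-1, p and p+1..2p-1 contribute 1, 2^p - 2, 2 / 4^p and 2^p - 2 in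
  this order.\<close>

lemma inner_sum_mod:
  "rat_cong_pow p 2 (\<Sum>j<2 * p. of_nat ((p + j - 1) choose j) * central j)
     (1 + (2 ^ p - 2) + (2 / 4 ^ p + (2 ^ p - 2)))"
proof -
  define f where "f j = of_nat ((p + j - 1) choose j) * central j" for j
  have "p > 0" using m by simp
  then have range: "{..<p} = insert 0 {1..p - 1}" by auto
  have "(\<Sum>j<2 * p. f j) = (\<Sum>j<p. f j) + (\<Sum>i<p. f (p + i))"
    unfolding mult_2 by (rule sum_lessThan_add)
  also have "\<dots> = f 0 + (\<Sum>i=1..p - 1. f i) + (f p + (\<Sum>i=1..p - 1. f (p + i)))"
    unfolding range by simp
  finally have split: "(\<Sum>j<2 * p. f j) = \<dots>" .
  \<comment> \<open>With p in front, the cofactor is needed only modulo p. At j = p the division by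
    j takes this factor back, so that index is treated separately in \<open>mid\<close>.\<close>
  have step: "f j = of_nat p * (of_nat ((p + (j - 1)) choose p) * central j / of_nat j)" if "j \<ge> 1" for j
    unfolding f_def binomial_shift[OF that] by simp
  have low: "rat_cong_pow p 2 (f i) (of_nat p * (central i / of_nat i))" if i: "i \<in> {1..p - 1}" for i
  proof -
    have "i - 1 < p" using i by auto
    then have "rat_cong_pow p 1 (of_nat ((p + (i - 1)) choose p)) 1"
      using binomial_add_mod[of "i - 1" 0] by simp
    then have "rat_cong_pow p 1 (of_nat ((p + (i - 1)) choose p) * central i / of_nat i) (1 * central i / of_nat i)"
      using i by (intro rat_cong_pow_divide_nat rat_cong_pow_mult p_integral_central
          p_integral_of_nat rat_cong_pow_refl coprime_below) auto
    from rat_cong_pow_prime_mult[OF this] show ?thesis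
      using step i by (simp add: numeral_2_eq_2)
  qed
  have high: "rat_cong_pow p 2 (f (p + i)) (of_nat p * (central i / of_nat i))" if i: "i \<in> {1..p - 1}" for i
  proof -
    have i': "0 < i" "i < p" using i by auto
    \<comment> \<open>The coefficient becomes binom(2p,p), which is 2 modulo p and cancels the 1/2
      of \<open>central_add_mod\<close>; the upper block therefore repeats the lower one.\<close>
    have "rat_cong_pow p 1 (of_nat ((Suc 1 * p + (i - 1)) choose p)) (of_nat ((Suc 1 * p) choose p))"
      using i' by (intro binomial_add_mod) auto
    moreover have "Suc 1 * p = 2 * p" by simp
    ultimately have "rat_cong_pow p 1 (of_nat ((2 * p + (i - 1)) choose p)) 2"
      using rat_cong_pow_trans[OF _ rat_cong_pow_lower[OF binomial_double_prime_mod]] by (simp only:)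
    moreover have "2 * p + (i - 1) = p + (p + i - 1)" using i' by simp
    ultimately have "rat_cong_pow p 1 (of_nat ((p + (p + i - 1)) choose p)) 2" by (simp only:)
    then have "rat_cong_pow p 1 (of_nat ((p + (p + i - 1)) choose p) * central (p + i) / of_nat (1 * p + i))
        (2 * (1 / 2 * central i) / of_nat i)"
    proof (intro rat_cong_divide rat_cong_pow_mult central_add_mod)
      show "p_integral p (1 / 2 * central i)"
        using p_integral_divide_nat[OF p_integral_central[of i], of 2] coprime_two_power[of 1]
        by simp
      show "coprime (1 * p + i) p" "coprime i p"
        using i' by (simp_all only: coprime_mult_add coprime_below)
    qed (use i' in \<open>simp_all only: p_integral_of_nat p_integral_central
        p_integral_mult rat_cong_add_prime\<close>)
    from rat_cong_pow_prime_mult[OF this] show ?thesis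
      using step[of "p + i"] i' by (simp add: numeral_2_eq_2)
  qed
  have part: "rat_cong_pow p 2 (\<Sum>i=1..p - 1. g i) (2 ^ p - 2)"
    if "\<And>i. i \<in> {1..p - 1} \<Longrightarrow> rat_cong_pow p 2 (g i) (of_nat p * (central i / of_nat i))" for g
  proof (rule rat_cong_pow_trans[OF _ sum_central_mod])
    show "rat_cong_pow p 2 (\<Sum>i=1..p - 1. g i) (of_nat p * (\<Sum>i=1..p - 1. central i / of_nat i))"
      unfolding sum_distrib_left by (rule rat_cong_pow_sum[OF that])
  qed
  have mid: "rat_cong_pow p 2 (f p) (2 / 4 ^ p)"
  proof -
    let ?C = "of_nat ((2 * p) choose p) :: rat"
    \<comment> \<open>Halving binom(2p,p) gives binom(2p-1,p), so \<open>f p\<close> is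
      binom(2p,p)^2 / (2 * 4^p).\<close>
    have "(2 * p) * ((2 * p - 1) choose p) = p * ((2 * p) choose p)"
      using binomial_absorb_comp[of "2 * p" p] by simp
    then have "2 * ((2 * p - 1) choose p) = (2 * p) choose p"
      using \<open>p > 0\<close> by simp
    then have "2 * of_nat ((2 * p - 1) choose p) = ?C"
      by (metis of_nat_mult of_nat_numeral)
    then have "f p = ?C * ?C / of_nat (2 * 4 ^ p)"
      unfolding f_def central_def mult_2[symmetric] by (simp add: field_simps)
    moreover have "rat_cong_pow p 2 \<dots> (2 * 2 / of_nat (2 * 4 ^ p))"
      using coprime_four_power[of 1] coprime_two_power[of 1]
      by (intro rat_cong_pow_divide_nat rat_cong_pow_mult binomial_double_prime_mod) (simp_all add: p)
    ultimately show ?thesis by simp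
  qed
  have "f 0 = 1" by (simp add: f_def)
  then show ?thesis
    using rat_cong_pow_add[OF rat_cong_pow_add[OF rat_cong_pow_refl part[OF low]]
        rat_cong_pow_add[OF mid part[OF high]], of "f 0"]
    unfolding f_def[symmetric] split by simp
qed

end

end

section \<open>The congruence modulo p^3\<close>

theorem theorem1p2:
  fixes p :: nat
  assumes "prime p" and "odd p"
  shows "rat_cong_pow p 3
    (\<Sum>k = 0..p - 1.
       (92 * of_nat k ^ 2 + 61 * of_nat k + 9) / ((2 * of_nat k + 1) * 64 ^ k)
       * of_nat ((2 * k) choose k) * of_nat ((3 * k) choose k) * of_nat ((4 * k) choose (2 * k)))
    (9 * of_nat p)"
proof -
  note p = \<open>prime p\<close>
  obtain m where m: "p = 2 * m + 1" using \<open>odd p\<close> by (rule oddE)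
  define A where "A = (\<Sum>j<2 * p. of_nat ((p + j - 1) choose j) * central j)"
  define w where "w = (2 :: rat) ^ p"
  \<comment> \<open>The Fermat quotient of 2; it makes the powers of p in w - 2 explicit.\<close>
  define h where "h = (w - 2) / of_nat p"
  have "{0..p - 1} = {..<p}" using m by auto
  \<comment> \<open>The factor N of \<open>truncated_sum_eq\<close> is put in front, so the cofactor
    is needed only modulo p^2.\<close>
  then have sum: "(\<Sum>k = 0..p - 1.
       (92 * of_nat k ^ 2 + 61 * of_nat k + 9) / ((2 * of_nat k + 1) * 64 ^ k)
       * of_nat ((2 * k) choose k) * of_nat ((3 * k) choose k) * of_nat ((4 * k) choose (2 * k)) :: rat)
     = of_nat p * (12 * (central p * A))"
    using truncated_sum_eq[of p] m by (simp add: A_def mult_ac)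
  have w4: "4 ^ p = w * w" "w \<noteq> 0"
    by (simp_all add: w_def power_mult_distrib[symmetric])
  have h: "p_integral p h" "w = 2 + of_nat p * h"
    using power_two_mod_prime[OF p m] p_nonzero[OF p] by (simp_all add: rat_cong_pow_def h_def w_def)
  \<comment> \<open>This is w^4, the denominator of the error term below.\<close>
  have c: "coprime (2 ^ p * 2 ^ p * (2 ^ p * 2 ^ p)) p"
    using coprime_two_power[OF p m, of p] by simp
  have int: "p_integral p (x / (w * w * (w * w)))" if "p_integral p x" for x
    using p_integral_divide_nat[OF p that c] by (simp add: w_def)
  have "rat_cong_pow p 2 (12 * (central p * A)) (12 * (2 / 4 ^ p * (1 + (2 ^ p - 2) + (2 / 4 ^ p + (2 ^ p - 2)))))"
  proof (intro rat_cong_pow_mult_left[OF p] rat_cong_pow_mult[OF p] central_prime_mod[OF p m])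
    have "p_integral p (2 / 4 ^ p)"
      using p_integral_divide_nat[OF p _ coprime_four_power[OF p m], of 2 p] p by simp
    then show "p_integral p (1 + (2 ^ p - 2) + (2 / 4 ^ p + (2 ^ p - 2)))"
      using p by (intro p_integral_add[OF p] p_integral_diff[OF p]) simp_all
    show "rat_cong_pow p 2 A (1 + (2 ^ p - 2) + (2 / 4 ^ p + (2 ^ p - 2)))"
      unfolding A_def by (rule inner_sum_mod[OF p m])
  qed (simp_all add: p p_integral_central[OF p m])
  moreover have "rat_cong_pow p 2 (12 * (2 / 4 ^ p * (1 + (2 ^ p - 2) + (2 / 4 ^ p + (2 ^ p - 2))))) 9"
  proof (rule rat_cong_powI[OF p])
    \<comment> \<open>With 4^p = w^2 the error is a rational function of w whose numerator has the
      triple root 2. Two of its factors w - 2 supply p^2; the third stays in the integral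
      cofactor.\<close>
    have "12 * (2 / (w * w) * (1 + (w - 2) + (2 / (w * w) + (w - 2)))) - 9
        = (w - 2) ^ 2 * (- 3 * (w - 2) * (3 * w + 2) / (w * w * (w * w)))"
      using w4(2) by (simp add: divide_simps) (simp add: algebra_simps power2_eq_square)
    also have "(w - 2) ^ 2 = of_nat p ^ 2 * h ^ 2"
      by (simp add: h(2) power_mult_distrib)
    finally show "12 * (2 / 4 ^ p * (1 + (2 ^ p - 2) + (2 / 4 ^ p + (2 ^ p - 2)))) - 9
        = of_nat p ^ 2 * (h ^ 2 * (- 3 * (w - 2) * (3 * w + 2) / (w * w * (w * w))))"
      unfolding w4(1) w_def[symmetric] by (simp only: mult.assoc)
    have "p_integral p w" by (simp add: w_def p)
    then show "p_integral p (h ^ 2 * (- 3 * (w - 2) * (3 * w + 2) / (w * w * (w * w))))"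
      using h(1) p by (intro p_integral_mult[OF p] int) simp_all
  qed
  ultimately have "rat_cong_pow p 2 (12 * (central p * A)) 9"
    by (rule rat_cong_pow_trans[OF p])
  from rat_cong_pow_prime_mult[OF p this] show ?thesis
    unfolding sum by (simp add: mult.commute numeral_3_eq_3 numeral_2_eq_2)
qed

end
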